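(* Let $\mathcal{P}$ be an $L$-convex polyomino and let $\mathcal{P}^*$ be the Ferrer diagram projected by $\mathcal{P}$. Then the bipartite graphs $G_{\mathcal{P}}$ and $G_{\mathcal{P}^*}$ are isomorphic.
   Context: A cell is a set $C=[a,a+(1,1)]$ with $a\in\mathbb{N}^2$ its lower left corner, where $[(i,j),(k,\ell)]=\{(r,s)\in\mathbb{N}^2: i\le r\le k,\ j\le s\le \ell\}$; its vertices are $a,a+(1,0),a+(0,1),a+(1,1)$ and its edges are the four sides of the unit square. A finite collection $\mathcal{P}$ of cells is a polyomino if any two of its cells can be joined by a sequence of cells of $\mathcal{P}$ in which consecutive cells share an edge; such a sequence with distinct cells is a path. $\mathcal{P}$ is convex if whenever two cells of $\mathcal{P}$ lie in the same row (resp. column) all cells between them in that row (resp. column) belong to $\mathcal{P}$. A path $C_1,\dots,C_q$, with $(i_k,j_k)$ the lower left corner of $C_k$, has a change of direction at $C_k$ ($2\le k\le q-1$) if $i_{k-1}\ne i_{k+1}$ and $j_{k-1}\ne j_{k+1}$. A convex polyomino is $L$-convex if any two of its cells can be connected by a path of its cells with at most one change of direction. After translation the bounding box of $\mathcal{P}$ (smallest rectangle containing it) is $[(0,0),(m,n)]$; rows of cells are numbered $1,\dots,n$ from top to bottom, columns $1,\dots,m$ from left to right. The horizontal projections $H_{\mathcal{P}}=(h_1,\dots,h_n)$ and vertical projections $V_{\mathcal{P}}=(v_1,\dots,v_m)$ record the number $h_i$ of cells of $\mathcal{P}$ in row $i$ and the number $v_j$ of cells in column $j$. A Ferrer diagram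 is a polyomino such that, for all $i,j$, if the cell in row $i$ and column $j$ belongs to it, then so do all cells in row $s\le i$ and column $r\le j$ (so its first row and first column are full). The Ferrer diagram $\mathcal{P}^*$ projected by the $L$-convex polyomino $\mathcal{P}$ is the unique (up to translation) Ferrer diagram whose horizontal and vertical projections are the entries of $H_{\mathcal{P}}$ and of $V_{\mathcal{P}}$, respectively, rearranged in weakly decreasing order. Graph $G_{\mathcal{P}}$ (for a convex polyomino with bounding box $[(0,0),(m,n)]$): a horizontal edge interval of $\mathcal{P}$ is an interval $[(i,j),(k,j)]$ such that $\{(r,j),(r+1,j)\}$ is an edge of a cell of $\mathcal{P}$ for all $r=i,\dots,k-1$; it is maximal if not strictly contained in another one; vertical edge intervals are defined analogously. $\mathcal{P}$ has exactly $n+1$ maximal horizontal edge intervals $H_0,\dots,H_n$ (numbered from top to bottom) and $m+1$ maximal vertical edge intervals $V_0,\dots,V_m$ (numbered from left to right). $G_{\mathcal{P}}$ is the bipartite graph on $\{x_0,\dots,x_m\}\sqcup\{y_0,\dots,y_n\}$ with $\{x_i,y_j\}$ an edge iff $V_i\cap H_j\neq\emptyset$. *)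

theory Defs
  imports Main
begin

section \<open>Cells and polyominoes\<close>

type_synonym point = "nat \<times> nat"

definition grid_interval :: "point \<Rightarrow> point \<Rightarrow> point set" where
  "grid_interval a b = {(r, s). fst a \<le> r \<and> r \<le> fst b \<and> snd a \<le> s \<and> s \<le> snd b}"

text \<open>A cell is represented by its lower left corner, so a collection of cells is a set of points.\<close>

fun cell_vertices :: "point \<Rightarrow> point set" where
  "cell_vertices (i, j) = grid_interval (i, j) (i + 1, j + 1)"

fun cell_edges :: "point \<Rightarrow> point set set" where
  "cell_edges (i, j) =
     {{(i, j), (i + 1, j)}, {(i, j + 1), (i + 1, j + 1)},
      {(i, j), (i, j + 1)}, {(i + 1, j), (i + 1, j + 1)}}"

definition share_edge :: "point \<Rightarrow> point \<Rightarrow> bool" where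
  "share_edge C D \<longleftrightarrow> cell_edges C \<inter> cell_edges D \<noteq> {}"

definition cell_sequence :: "point set \<Rightarrow> point \<Rightarrow> point \<Rightarrow> point list \<Rightarrow> bool" where
  "cell_sequence P C D Cs \<longleftrightarrow>
     Cs \<noteq> [] \<and> hd Cs = C \<and> last Cs = D \<and> set Cs \<subseteq> P \<and> successively share_edge Cs"

definition cell_path :: "point set \<Rightarrow> point \<Rightarrow> point \<Rightarrow> point list \<Rightarrow> bool" where
  "cell_path P C D Cs \<longleftrightarrow> cell_sequence P C D Cs \<and> distinct Cs"

text \<open>Polyominoes are nonempty, so that the bounding box exists.\<close>

definition polyomino :: "point set \<Rightarrow> bool" where
  "polyomino P \<longleftrightarrow> finite P \<and> P \<noteq> {} \<and> (\<forall>C\<in>P. \<forall>D\<in>P. \<exists>Cs. cell_sequence P C D Cs)"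

definition convex_polyomino :: "point set \<Rightarrow> bool" where
  "convex_polyomino P \<longleftrightarrow> polyomino P \<and>
     (\<forall>i k i' j. (i, j) \<in> P \<and> (i', j) \<in> P \<and> i \<le> k \<and> k \<le> i' \<longrightarrow> (k, j) \<in> P) \<and>
     (\<forall>i j k j'. (i, j) \<in> P \<and> (i, j') \<in> P \<and> j \<le> k \<and> k \<le> j' \<longrightarrow> (i, k) \<in> P)"

text \<open>Positions in the list are counted from 0; both end positions are excluded.\<close>

definition changes_of_direction :: "point list \<Rightarrow> nat set" where
  "changes_of_direction Cs = {k. 1 \<le> k \<and> k + 1 < length Cs \<and>
     fst (Cs ! (k - 1)) \<noteq> fst (Cs ! (k + 1)) \<and> snd (Cs ! (k - 1)) \<noteq> snd (Cs ! (k + 1))}"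

definition L_convex :: "point set \<Rightarrow> bool" where
  "L_convex P \<longleftrightarrow> convex_polyomino P \<and>
     (\<forall>C\<in>P. \<forall>D\<in>P. \<exists>Cs. cell_path P C D Cs \<and> card (changes_of_direction Cs) \<le> 1)"


section \<open>Bounding box, rows, columns and projections\<close>

definition vertices :: "point set \<Rightarrow> point set" where
  "vertices P = (\<Union>C\<in>P. cell_vertices C)"

text \<open>The bounding box of \<open>P\<close> is the rectangle
  \<open>grid_interval (box_left P, box_bottom P) (box_right P, box_top P)\<close>. Polyominoes are not assumed
  to be translated to the origin; rows and columns are numbered relative to the box.\<close>

definition box_left :: "point set \<Rightarrow> nat" where
  "box_left P = Min (fst ` vertices P)"

definition box_right :: "point set \<Rightarrow> nat" where
  "box_right P = Max (fst ` vertices P)"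

definition box_bottom :: "point set \<Rightarrow> nat" where
  "box_bottom P = Min (snd ` vertices P)"

definition box_top :: "point set \<Rightarrow> nat" where
  "box_top P = Max (snd ` vertices P)"

definition num_rows :: "point set \<Rightarrow> nat" where
  "num_rows P = box_top P - box_bottom P"

definition num_cols :: "point set \<Rightarrow> nat" where
  "num_cols P = box_right P - box_left P"

text \<open>Rows are numbered from 1 from top to bottom, columns from 1 from left to right. The cells
  of row 1 have their upper edge, and those of column 1 their left edge, on the boundary of the
  box.\<close>

definition row :: "point set \<Rightarrow> nat \<Rightarrow> point set" where
  "row P i = {C \<in> P. snd C + i = box_top P}"

definition col :: "point set \<Rightarrow> nat \<Rightarrow> point set" where
  "col P j = {C \<in> P. fst C + 1 = box_left P + j}"

definition horizontal_projections :: "point set \<Rightarrow> nat list" where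
  "horizontal_projections P = map (\<lambda>i. card (row P i)) [1..<num_rows P + 1]"

definition vertical_projections :: "point set \<Rightarrow> nat list" where
  "vertical_projections P = map (\<lambda>j. card (col P j)) [1..<num_cols P + 1]"


section \<open>Ferrer diagrams\<close>

text \<open>\<open>row P i \<inter> col P j\<close> contains at most one cell, the one in row \<open>i\<close> and column \<open>j\<close>.\<close>

definition ferrer_diagram :: "point set \<Rightarrow> bool" where
  "ferrer_diagram P \<longleftrightarrow> polyomino P \<and>
     (\<forall>i j s r. row P i \<inter> col P j \<noteq> {} \<and> 1 \<le> s \<and> s \<le> i \<and> 1 \<le> r \<and> r \<le> j
        \<longrightarrow> row P s \<inter> col P r \<noteq> {})"

text \<open>The projected Ferrer diagram is determined up to translation; the representative with the
  lower left corner of its bounding box at the origin is chosen.\<close>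

definition projected_ferrer_diagram :: "point set \<Rightarrow> point set" where
  "projected_ferrer_diagram P = (THE Q. ferrer_diagram Q \<and> box_left Q = 0 \<and> box_bottom Q = 0 \<and>
     horizontal_projections Q = rev (sort (horizontal_projections P)) \<and>
     vertical_projections Q = rev (sort (vertical_projections P)))"


section \<open>The bipartite graph of a convex polyomino\<close>

text \<open>Edge intervals have positive length: a degenerate interval at a grid point off \<open>P\<close>
  would be maximal.\<close>

definition horizontal_edge_interval :: "point set \<Rightarrow> point set \<Rightarrow> bool" where
  "horizontal_edge_interval P I \<longleftrightarrow> (\<exists>i j k. i < k \<and> I = grid_interval (i, j) (k, j) \<and>
     (\<forall>r. i \<le> r \<and> r < k \<longrightarrow> (\<exists>C\<in>P. {(r, j), (r + 1, j)} \<in> cell_edges C)))"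

definition vertical_edge_interval :: "point set \<Rightarrow> point set \<Rightarrow> bool" where
  "vertical_edge_interval P I \<longleftrightarrow> (\<exists>i j k. j < k \<and> I = grid_interval (i, j) (i, k) \<and>
     (\<forall>s. j \<le> s \<and> s < k \<longrightarrow> (\<exists>C\<in>P. {(i, s), (i, s + 1)} \<in> cell_edges C)))"

definition maximal_horizontal_edge_interval :: "point set \<Rightarrow> point set \<Rightarrow> bool" where
  "maximal_horizontal_edge_interval P I \<longleftrightarrow>
     horizontal_edge_interval P I \<and> \<not> (\<exists>J. horizontal_edge_interval P J \<and> I \<subset> J)"

definition maximal_vertical_edge_interval :: "point set \<Rightarrow> point set \<Rightarrow> bool" where
  "maximal_vertical_edge_interval P I \<longleftrightarrow>
     vertical_edge_interval P I \<and> \<not> (\<exists>J. vertical_edge_interval P J \<and> I \<subset> J)"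

text \<open>In a convex polyomino each horizontal (vertical) grid line meeting the bounding box carries
  exactly one maximal horizontal (vertical) edge interval. So the \<open>j\<close>-th one from the top
  (the \<open>i\<close>-th one from the left), counted from 0, is the one on the line at distance \<open>j\<close> from the
  top (\<open>i\<close> from the left) of the box.\<close>

definition H_interval :: "point set \<Rightarrow> nat \<Rightarrow> point set" where
  "H_interval P j =
     (THE I. maximal_horizontal_edge_interval P I \<and> (\<forall>a\<in>I. snd a + j = box_top P))"

definition V_interval :: "point set \<Rightarrow> nat \<Rightarrow> point set" where
  "V_interval P i =
     (THE I. maximal_vertical_edge_interval P I \<and> (\<forall>a\<in>I. fst a = box_left P + i))"

record 'a bipartite_graph =
  left_part :: "'a set"
  right_part :: "'a set"
  edges :: "'a set set"

text \<open>The vertex \<open>x\<^sub>i\<close> is \<open>Inl i\<close> and the vertex \<open>y\<^sub>j\<close> is \<open>Inr j\<close>.\<close>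

definition polyomino_graph :: "point set \<Rightarrow> (nat + nat) bipartite_graph" where
  "polyomino_graph P =
     \<lparr> left_part = Inl ` {0..num_cols P},
       right_part = Inr ` {0..num_rows P},
       edges = {{Inl i, Inr j} | i j. i \<le> num_cols P \<and> j \<le> num_rows P \<and>
                  V_interval P i \<inter> H_interval P j \<noteq> {}} \<rparr>"

text \<open>Isomorphism of graphs that moreover respects the two parts.\<close>

definition bipartite_graph_isomorphic :: "'a bipartite_graph \<Rightarrow> 'b bipartite_graph \<Rightarrow> bool" where
  "bipartite_graph_isomorphic G G' \<longleftrightarrow>
     (\<exists>f. bij_betw f (left_part G \<union> right_part G) (left_part G' \<union> right_part G') \<and>
          f ` left_part G = left_part G' \<and> f ` right_part G = right_part G' \<and>
          (\<forall>u \<in> left_part G \<union> right_part G. \<forall>v \<in> left_part G \<union> right_part G.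
             {u, v} \<in> edges G \<longleftrightarrow> {f u, f v} \<in> edges G'))"

end

theory Submission
  imports Defs "HOL-Combinatorics.Permutations"
begin

text \<open>In an \<open>L\<close>-convex polyomino the rows are pairwise comparable by inclusion, and so are the
  columns. The intervals \<open>V\<^sub>i\<close> and \<open>H\<^sub>j\<close> meet iff the grid point where their lines cross is a vertex
  of a cell, so neighbourhoods in the graph are nested as well. In a bipartite graph with nested
  neighbourhoods, adjacency of two vertices is determined by their degrees and the degree multisets
  of both sides. The degrees of the \<open>V\<^sub>i\<close> are the column sizes plus one, with the longest column,
  which meets every row, counted twice, and likewise for the \<open>H\<^sub>j\<close>; hence the degree multisets depend
  only on the multisets of projections.\<close>

section \<open>Nested sets of cells\<close>

text \<open>A set of cells is a relation: \<open>P `` {x}\<close> is a column, and the converse is the reflection in the diagonal.\<close>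

definition nested_cells :: "point set \<Rightarrow> bool" where
  "nested_cells P \<longleftrightarrow> finite P \<and> P \<noteq> {} \<and>
     (\<forall>i k i' j. (i, j) \<in> P \<and> (i', j) \<in> P \<and> i \<le> k \<and> k \<le> i' \<longrightarrow> (k, j) \<in> P) \<and>
     (\<forall>i j k j'. (i, j) \<in> P \<and> (i, j') \<in> P \<and> j \<le> k \<and> k \<le> j' \<longrightarrow> (i, k) \<in> P) \<and>
     (\<forall>x y x' y'. (x, y) \<in> P \<and> (x', y') \<in> P \<longrightarrow> (x, y') \<in> P \<or> (x', y) \<in> P)"

text \<open>The crossing property says both that any two columns are comparable by inclusion and
  that any two rows are: incomparable columns \<open>x\<close> and \<open>x'\<close> would have
  cells \<open>(x, y)\<close> and \<open>(x', y')\<close> violating it.\<close>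

lemma nested_cells_finite: "nested_cells P \<Longrightarrow> finite P"
  and nested_cells_nonempty: "nested_cells P \<Longrightarrow> P \<noteq> {}"
  and nested_cells_row:
    "nested_cells P \<Longrightarrow> (i, j) \<in> P \<Longrightarrow> (i', j) \<in> P \<Longrightarrow> i \<le> k \<Longrightarrow> k \<le> i' \<Longrightarrow> (k, j) \<in> P"
  and nested_cells_col:
    "nested_cells P \<Longrightarrow> (i, j) \<in> P \<Longrightarrow> (i, j') \<in> P \<Longrightarrow> j \<le> k \<Longrightarrow> k \<le> j' \<Longrightarrow> (i, k) \<in> P"
  and nested_cells_cross:
    "nested_cells P \<Longrightarrow> (x, y) \<in> P \<Longrightarrow> (x', y') \<in> P \<Longrightarrow> (x, y') \<in> P \<or> (x', y) \<in> P"
  unfolding nested_cells_def by blast+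

text \<open>The two convexity clauses swap under reflection and the crossing clause is self-dual.
  Facts about columns therefore yield facts about rows when applied to
  \<open>P\<inverse>\<close>.\<close>

lemma nested_cells_converse [simp]: "nested_cells (P\<inverse>) \<longleftrightarrow> nested_cells P"
proof -
  have "nested_cells (P\<inverse>)" if "nested_cells P" for P
    unfolding nested_cells_def converse_iff finite_converse
  proof (intro conjI allI impI; (elim conjE)?)
    show "finite P" "P\<inverse> \<noteq> {}"
      using nested_cells_finite[OF that] nested_cells_nonempty[OF that] by auto
  qed (use nested_cells_row[OF that] nested_cells_col[OF that] nested_cells_cross[OF that] in blast)+
  from this[of P] this[of "P\<inverse>"] show ?thesis by auto
qed

lemma finite_convex_nat_interval:
  fixes A :: "nat set"
  assumes "finite A" "A \<noteq> {}" and conv: "\<And>i j k. i \<in> A \<Longrightarrow> j \<in> A \<Longrightarrow> i \<le> k \<Longrightarrow> k \<le> j \<Longrightarrow> k \<in> A"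
  obtains a b where "a < b" "A = {a..<b}"
proof
  show "Min A < Suc (Max A)" using assms(1,2) by (simp add: le_imp_less_Suc)
  show "A = {Min A..<Suc (Max A)}"
  proof
    show "A \<subseteq> {Min A..<Suc (Max A)}" using assms(1) by (auto simp: less_Suc_eq_le)
    show "{Min A..<Suc (Max A)} \<subseteq> A"
      using conv[OF Min_in[OF assms(1,2)] Max_in[OF assms(1,2)]] by (simp add: subset_iff)
  qed
qed

lemma nested_cells_column_interval:
  assumes "nested_cells P" "x \<in> fst ` P"
  obtains a b where "a < b" "P `` {x} = {a..<b}"
proof (rule finite_convex_nat_interval[of "P `` {x}"])
  show "finite (P `` {x})" using nested_cells_finite[OF assms(1)] by (rule finite_Image)
  show "P `` {x} \<noteq> {}" using assms(2) by force
  show "k \<in> P `` {x}" if "i \<in> P `` {x}" "j \<in> P `` {x}" "i \<le> k" "k \<le> j" for i j k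
    using nested_cells_col[OF assms(1)] that by blast
qed (use that in blast)

text \<open>By crossing, any two nonempty columns have a common row, and convexity of that row fills
  the columns between them.\<close>

lemma nested_cells_fst_interval:
  assumes "nested_cells P"
  obtains a b where "a < b" "fst ` P = {a..<b}"
proof (rule finite_convex_nat_interval[of "fst ` P"])
  show "finite (fst ` P)" "fst ` P \<noteq> {}"
    using nested_cells_finite[OF assms] nested_cells_nonempty[OF assms] by auto
  fix i j k assume "i \<in> fst ` P" "j \<in> fst ` P" and le: "i \<le> k" "k \<le> j"
  then obtain y y' where "(i, y) \<in> P" "(j, y') \<in> P" by auto
  with nested_cells_cross[OF assms this] obtain z where "(i, z) \<in> P" "(j, z) \<in> P" by blast
  with le have "(k, z) \<in> P" using nested_cells_row[OF assms] by blast
  then show "k \<in> fst ` P" by force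
qed (use that in blast)

section \<open>Vertices and the bounding box\<close>

lemma vertices_iff:
  "(x, y) \<in> vertices P \<longleftrightarrow> (\<exists>u v. (u, v) \<in> P \<and> (x = u \<or> x = Suc u) \<and> (y = v \<or> y = Suc v))"
proof -
  have "(u \<le> x \<and> x \<le> u + 1) \<longleftrightarrow> (x = u \<or> x = Suc u)" for u x :: nat by auto
  then show ?thesis by (auto simp: vertices_def grid_interval_def Bex_def)
qed

lemma vertices_converse [simp]: "vertices (P\<inverse>) = (vertices P)\<inverse>"
  unfolding set_eq_iff split_paired_All converse_iff vertices_iff by blast

lemma finite_vertices: "finite P \<Longrightarrow> finite (vertices P)"
proof -
  have "finite (cell_vertices C)" for C
  proof (rule finite_subset)
    show "cell_vertices C \<subseteq> {..fst C + 1} \<times> {..snd C + 1}"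
      by (cases C) (auto simp: grid_interval_def)
  qed simp
  then show "finite P \<Longrightarrow> finite (vertices P)" by (simp add: vertices_def)
qed

lemma fst_converse: "fst ` (P\<inverse>) = snd ` P" and snd_converse: "snd ` (P\<inverse>) = fst ` P"
  by force+

lemma box_converse [simp]:
  "box_left (P\<inverse>) = box_bottom P" "box_right (P\<inverse>) = box_top P"
  "box_bottom (P\<inverse>) = box_left P" "box_top (P\<inverse>) = box_right P"
  "num_rows (P\<inverse>) = num_cols P" "num_cols (P\<inverse>) = num_rows P"
  by (simp_all add: box_left_def box_right_def box_bottom_def box_top_def num_rows_def
      num_cols_def fst_converse snd_converse)

lemma fst_vertices: "fst ` vertices P = fst ` P \<union> Suc ` fst ` P"
proof -
  have "x \<in> fst ` vertices P \<longleftrightarrow> (\<exists>y. (x, y) \<in> vertices P)" for x by force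
  moreover have "x \<in> fst ` P \<union> Suc ` fst ` P \<longleftrightarrow> (\<exists>u v. (u, v) \<in> P \<and> (x = u \<or> x = Suc u))" for x
    by force
  moreover have "(\<exists>y. (x, y) \<in> vertices P) \<longleftrightarrow> (\<exists>u v. (u, v) \<in> P \<and> (x = u \<or> x = Suc u))" for x
    unfolding vertices_iff by blast
  ultimately show ?thesis by (intro set_eqI) (simp only:)
qed

text \<open>With unit edges named by their lower ends, the union collects all end points. The one
  extra point is why a degree exceeds the number of edges by one.\<close>

lemma interval_Un_Suc: "a < b \<Longrightarrow> {a..<b} \<union> Suc ` {a..<b} = {a..b}"
  by auto

lemma box_horizontal_eqI:
  assumes "a < b" "fst ` P = {a..<b}"
  shows "box_left P = a" "box_right P = b"
proof -
  have "fst ` vertices P = {a..b}" using assms by (simp add: fst_vertices interval_Un_Suc del: image_Suc_atLeastLessThan)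
  then show "box_left P = a" "box_right P = b"
    using assms(1) by (auto simp: box_left_def box_right_def intro!: Min_eqI Max_eqI)
qed

lemma box_vertical_eqI:
  assumes "a < b" "snd ` P = {a..<b}"
  shows "box_bottom P = a" "box_top P = b"
  using box_horizontal_eqI[of a b "P\<inverse>"] assms by (simp_all add: fst_converse)

lemma nested_cells_fst:
  assumes "nested_cells P"
  shows "fst ` P = {box_left P..<box_right P}" "box_left P < box_right P"
proof -
  obtain a b where "a < b" "fst ` P = {a..<b}" using nested_cells_fst_interval[OF assms] .
  with box_horizontal_eqI[OF this] show "fst ` P = {box_left P..<box_right P}"
    "box_left P < box_right P" by simp_all
qed

lemma nested_cells_snd:
  assumes "nested_cells P"
  shows "snd ` P = {box_bottom P..<box_top P}" "box_bottom P < box_top P"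
  using nested_cells_fst[of "P\<inverse>"] assms by (simp_all add: fst_converse)

text \<open>The offset from a cell to its corner is chosen independently in each coordinate, so the
  cell \<open>(u, v')\<close> or \<open>(u', v)\<close> supplied by crossing has the required point
  as a corner.\<close>

lemma nested_cells_vertices_cross:
  assumes "nested_cells P" "(x, y) \<in> vertices P" "(x', y') \<in> vertices P"
  shows "(x, y') \<in> vertices P \<or> (x', y) \<in> vertices P"
proof -
  obtain u v where uv: "(u, v) \<in> P" "x = u \<or> x = Suc u" "y = v \<or> y = Suc v"
    using assms(2) unfolding vertices_iff by blast
  obtain u' v' where uv': "(u', v') \<in> P" "x' = u' \<or> x' = Suc u'" "y' = v' \<or> y' = Suc v'"
    using assms(3) unfolding vertices_iff by blast
  have "(u, v') \<in> P \<or> (u', v) \<in> P" using nested_cells_cross[OF assms(1) uv(1) uv'(1)] .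
  then show ?thesis unfolding vertices_iff using uv(2,3) uv'(2,3) by blast
qed

section \<open>Edge intervals\<close>

text \<open>The lower ends of the unit edges on the vertical line at \<open>x\<close>: such an edge
  bounds a cell to its right or to its left. Writing \<open>x = Suc u\<close> avoids truncated
  subtraction at 0.\<close>

definition line_edges :: "point set \<Rightarrow> nat \<Rightarrow> nat set" where
  "line_edges P x = {s. (x, s) \<in> P \<or> (\<exists>u. x = Suc u \<and> (u, s) \<in> P)}"

lemma vertical_edge_iff:
  "(\<exists>C\<in>P. {(x, s), (x, s + 1)} \<in> cell_edges C) \<longleftrightarrow> s \<in> line_edges P x"
proof -
  have "(\<exists>C\<in>P. {(x, s), (x, s + 1)} \<in> cell_edges C) \<longleftrightarrow>
    (\<exists>u v. (u, v) \<in> P \<and> {(x, s), (x, s + 1)} \<in> cell_edges (u, v))" by (simp add: Bex_def)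
  also have "\<dots> \<longleftrightarrow> (\<exists>u v. (u, v) \<in> P \<and> s = v \<and> (x = u \<or> x = Suc u))"
    by (auto simp: doubleton_eq_iff)
  finally show ?thesis by (auto simp: line_edges_def)
qed

lemma vertical_edge_interval_iff:
  "vertical_edge_interval P I \<longleftrightarrow>
     (\<exists>i j k. j < k \<and> I = grid_interval (i, j) (i, k) \<and> {j..<k} \<subseteq> line_edges P i)"
  unfolding vertical_edge_interval_def vertical_edge_iff by (simp add: subset_iff)

lemma vertices_column: "vertices P `` {x} = line_edges P x \<union> Suc ` line_edges P x"
  unfolding set_eq_iff Image_singleton_iff vertices_iff line_edges_def by auto

text \<open>The longest column \<open>p\<close> contains all others, and convexity of the rows makes the columns
  grow up to \<open>p\<close> and shrink after it.\<close>

lemma nested_cells_peak: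
  assumes P: "nested_cells P"
  obtains p where "box_left P \<le> p" "p < box_right P" "P `` {p} = snd ` P"
    "\<And>x. x \<le> p \<Longrightarrow> line_edges P x = P `` {x}"
    "\<And>x. p \<le> x \<Longrightarrow> line_edges P (Suc x) = P `` {x}"
proof -
  have fin: "finite (P `` {x})" for x using nested_cells_finite[OF P] by (rule finite_Image)
  let ?S = "(\<lambda>x. card (P `` {x})) ` fst ` P"
  have S: "finite ?S" "?S \<noteq> {}"
    using nested_cells_finite[OF P] nested_cells_nonempty[OF P] by auto
  from Max_in[OF S] obtain p where p: "p \<in> fst ` P" "Max ?S = card (P `` {p})" by blast
  have mx: "card (P `` {x}) \<le> card (P `` {p})" if "x \<in> fst ` P" for x
    using Max_ge[OF S(1) imageI[OF that]] unfolding p(2) .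
  have sub: "P `` {x} \<subseteq> P `` {p}" for x
  proof (cases "x \<in> fst ` P")
    case True
    have "P `` {x} \<subseteq> P `` {p} \<or> P `` {p} \<subseteq> P `` {x}"
      using nested_cells_cross[OF P] by blast
    then show ?thesis using mx[OF True] card_seteq[OF fin, of "P `` {p}" x] by auto
  next
    case False
    then have "(x, y) \<notin> P" for y using image_eqI[of x fst "(x, y)" P] by auto
    then show ?thesis by blast
  qed
  show ?thesis
  proof
    show "box_left P \<le> p" "p < box_right P" using p(1) unfolding nested_cells_fst(1)[OF P] by auto
    have mem_p: "(p, y) \<in> P" if "(x, y) \<in> P" for x y using sub[of x] that by blast
    show "P `` {p} = snd ` P"
    proof
      show "P `` {p} \<subseteq> snd ` P" by force
      show "snd ` P \<subseteq> P `` {p}" using mem_p by auto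
    qed
    \<comment> \<open>Up to the peak a line carries the edges of the column on its right, beyond it
      those of the column on its left. Lines \<open>p\<close> and \<open>Suc p\<close> thus both
      carry the edges of column \<open>p\<close>.\<close>
    show "line_edges P x = P `` {x}" if "x \<le> p" for x
    proof -
      have "(x, y) \<in> P" if "x = Suc u" "(u, y) \<in> P" for u y
        using nested_cells_row[OF P that(2) mem_p[OF that(2)], of x] that(1) \<open>x \<le> p\<close> by simp
      then show ?thesis by (auto simp: line_edges_def)
    qed
    show "line_edges P (Suc x) = P `` {x}" if "p \<le> x" for x
    proof -
      have "(x, y) \<in> P" if "(Suc x, y) \<in> P" for y
        using nested_cells_row[OF P mem_p[OF that] that, of x] \<open>p \<le> x\<close> by simp
      then show ?thesis by (auto simp: line_edges_def)
    qed
  qed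
qed

text \<open>On either side of the peak a line carries the edges of a single nonempty column, which
  is an interval by convexity.\<close>

lemma nested_cells_line_edges:
  assumes P: "nested_cells P" and x: "box_left P \<le> x" "x \<le> box_right P"
  obtains a b where "a < b" "line_edges P x = {a..<b}"
proof -
  obtain p where p: "box_left P \<le> p" "p < box_right P"
    "\<And>x. x \<le> p \<Longrightarrow> line_edges P x = P `` {x}" "\<And>x. p \<le> x \<Longrightarrow> line_edges P (Suc x) = P `` {x}"
    using nested_cells_peak[OF P] by metis
  have "\<exists>u\<in>fst ` P. line_edges P x = P `` {u}"
  proof (cases "x \<le> p")
    case True
    then show ?thesis using p x nested_cells_fst[OF P] by (intro bexI[of _ x]) auto
  next
    case False
    then obtain u where "x = Suc u" "p \<le> u" by (cases x) auto
    then show ?thesis using p x nested_cells_fst[OF P] by (intro bexI[of _ u]) auto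
  qed
  then show ?thesis using nested_cells_column_interval[OF P] that by metis
qed

text \<open>All edges on the line form one run, and the interval \<open>J\<close> spanned by it
  contains every vertical edge interval with a point on the line. So \<open>J\<close> is the only
  maximal one there, and its points are the vertices on the line.\<close>

lemma maximal_vertical_edge_interval_iff:
  assumes P: "nested_cells P" and x: "box_left P \<le> x" "x \<le> box_right P"
  shows "maximal_vertical_edge_interval P I \<and> (\<forall>a\<in>I. fst a = x) \<longleftrightarrow>
    I = {x} \<times> vertices P `` {x}"
proof -
  obtain a b where ab: "a < b" "line_edges P x = {a..<b}"
    using nested_cells_line_edges[OF assms] .
  define J where "J = grid_interval (x, a) (x, b)"
  have J: "J = {x} \<times> vertices P `` {x}"
    unfolding J_def vertices_column ab(2) interval_Un_Suc[OF ab(1)] by (auto simp: grid_interval_def)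
  have edge_J: "vertical_edge_interval P J"
    unfolding vertical_edge_interval_iff J_def using ab by blast
  have below_J: "I \<subseteq> J" if I: "vertical_edge_interval P I" "(x, y) \<in> I" for I y
  proof -
    obtain i j k where ijk: "j < k" "I = grid_interval (i, j) (i, k)" "{j..<k} \<subseteq> line_edges P i"
      using I(1) unfolding vertical_edge_interval_iff by blast
    with I(2) have "i = x" by (auto simp: grid_interval_def)
    with ijk ab have "a \<le> j" "k \<le> b" by simp_all
    with ijk \<open>i = x\<close> show ?thesis by (auto simp: J_def grid_interval_def)
  qed
  have mem_J: "(x, a) \<in> J" using ab by (auto simp: J_def grid_interval_def)
  show ?thesis
  proof
    assume I: "maximal_vertical_edge_interval P I \<and> (\<forall>a\<in>I. fst a = x)"
    then have edge: "vertical_edge_interval P I" by (simp add: maximal_vertical_edge_interval_def)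
    \<comment> \<open>An empty \<open>I\<close> would satisfy the condition on first coordinates
      vacuously, so a point of \<open>I\<close> is exhibited to place it on the line
      \<open>x\<close>.\<close>
    then obtain q where "q \<in> I"
      unfolding vertical_edge_interval_iff grid_interval_def by fastforce
    with I have "(x, snd q) \<in> I" by (metis prod.collapse)
    from below_J[OF edge this] I edge_J show "I = {x} \<times> vertices P `` {x}"
      unfolding J[symmetric] maximal_vertical_edge_interval_def by blast
  next
    assume "I = {x} \<times> vertices P `` {x}"
    then have "I = J" using J by simp
    with edge_J below_J mem_J show "maximal_vertical_edge_interval P I \<and> (\<forall>a\<in>I. fst a = x)"
      unfolding maximal_vertical_edge_interval_def by (auto simp: J)
  qed
qed

lemma V_interval_eq:
  assumes "nested_cells P" "i \<le> num_cols P"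
  shows "V_interval P i = {box_left P + i} \<times> vertices P `` {box_left P + i}"
  unfolding V_interval_def
  by (subst maximal_vertical_edge_interval_iff)
    (use assms nested_cells_fst(2)[OF assms(1)] in \<open>auto simp: num_cols_def\<close>)

section \<open>Horizontal intervals by reflection in the diagonal\<close>

lemma horizontal_edge_iff:
  "(\<exists>C\<in>P. {(r, y), (r + 1, y)} \<in> cell_edges C) \<longleftrightarrow> r \<in> line_edges (P\<inverse>) y"
proof -
  have "(\<exists>C\<in>P. {(r, y), (r + 1, y)} \<in> cell_edges C) \<longleftrightarrow>
    (\<exists>u v. (u, v) \<in> P \<and> {(r, y), (r + 1, y)} \<in> cell_edges (u, v))" by (simp add: Bex_def)
  also have "\<dots> \<longleftrightarrow> (\<exists>u v. (u, v) \<in> P \<and> r = u \<and> (y = v \<or> y = Suc v))"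
    by (auto simp: doubleton_eq_iff)
  finally show ?thesis by (auto simp: line_edges_def)
qed

lemma horizontal_edge_interval_converse:
  "horizontal_edge_interval P I \<longleftrightarrow> vertical_edge_interval (P\<inverse>) (I\<inverse>)"
proof -
  have "(grid_interval (i, j) (k, l))\<inverse> = grid_interval (j, i) (l, k)" for i j k l
    by (auto simp: grid_interval_def)
  then have "I = grid_interval (i, j) (k, j) \<longleftrightarrow> I\<inverse> = grid_interval (j, i) (j, k)" for i j k
    by (metis converse_converse)
  then show ?thesis
    unfolding horizontal_edge_interval_def vertical_edge_interval_iff horizontal_edge_iff
    by (auto simp: subset_iff)
qed

lemma maximal_horizontal_edge_interval_converse:
  "maximal_horizontal_edge_interval P I \<longleftrightarrow> maximal_vertical_edge_interval (P\<inverse>) (I\<inverse>)"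
proof -
  have "I \<subset> J \<longleftrightarrow> I\<inverse> \<subset> J\<inverse>" for I J :: "point set" by auto
  then show ?thesis
    unfolding maximal_horizontal_edge_interval_def maximal_vertical_edge_interval_def
      horizontal_edge_interval_converse by (metis converse_converse)
qed

text \<open>This is the vertical case for \<open>P\<inverse>\<close>. Horizontal intervals are
  numbered downwards, which puts number \<open>j\<close> at height
  \<open>box_top P - j\<close>.\<close>

lemma H_interval_eq:
  assumes P: "nested_cells P" and j: "j \<le> num_rows P"
  shows "H_interval P j = ({box_top P - j} \<times> (vertices P)\<inverse> `` {box_top P - j})\<inverse>"
proof -
  have le: "box_bottom P \<le> box_top P - j" "j \<le> box_top P"
    using j nested_cells_snd(2)[OF P] by (auto simp: num_rows_def)
  have "maximal_horizontal_edge_interval P I \<and> (\<forall>a\<in>I. snd a + j = box_top P) \<longleftrightarrow>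
    I = ({box_top P - j} \<times> (vertices P)\<inverse> `` {box_top P - j})\<inverse>" for I
  proof -
    have "(\<forall>a\<in>I. snd a + j = box_top P) \<longleftrightarrow> (\<forall>a\<in>I\<inverse>. fst a = box_top P - j)"
    proof -
      \<comment> \<open>The bound \<open>j \<le> box_top P\<close> keeps the subtraction
        exact.\<close>
      have "b + j = box_top P \<longleftrightarrow> b = box_top P - j" for b using le(2) by arith
      moreover have "(\<forall>a\<in>I. snd a = c) \<longleftrightarrow> (\<forall>a\<in>I\<inverse>. fst a = c)" for c by force
      ultimately show ?thesis by simp
    qed
    then have "maximal_horizontal_edge_interval P I \<and> (\<forall>a\<in>I. snd a + j = box_top P) \<longleftrightarrow>
        I\<inverse> = {box_top P - j} \<times> (vertices P)\<inverse> `` {box_top P - j}"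
      using maximal_vertical_edge_interval_iff[of "P\<inverse>" "box_top P - j" "I\<inverse>"] P le
      unfolding maximal_horizontal_edge_interval_converse by simp
    then show ?thesis by (metis converse_converse)
  qed
  then show ?thesis unfolding H_interval_def by simp
qed

lemma V_H_intersect_iff:
  assumes "nested_cells P" "i \<le> num_cols P" "j \<le> num_rows P"
  shows "V_interval P i \<inter> H_interval P j \<noteq> {} \<longleftrightarrow> (box_left P + i, box_top P - j) \<in> vertices P"
  unfolding V_interval_eq[OF assms(1,2)] H_interval_eq[OF assms(1,3)] by auto

section \<open>Degrees\<close>

lemma mset_column_degrees:
  assumes P: "nested_cells P"
  shows "image_mset (\<lambda>x. card (vertices P `` {x})) (mset_set {box_left P..box_right P}) =
    add_mset (Suc (num_rows P))
      (image_mset (\<lambda>x. Suc (card (P `` {x}))) (mset_set {box_left P..<box_right P}))"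
    (is "image_mset ?d (mset_set {?l..?r}) = add_mset _ (image_mset ?c _)")
proof -
  obtain p where p: "?l \<le> p" "p < ?r" "P `` {p} = snd ` P"
    "\<And>x. x \<le> p \<Longrightarrow> line_edges P x = P `` {x}" "\<And>x. p \<le> x \<Longrightarrow> line_edges P (Suc x) = P `` {x}"
    using nested_cells_peak[OF P] by metis
  have d: "?d x = Suc (card (line_edges P x))" if x: "?l \<le> x" "x \<le> ?r" for x
  proof -
    obtain a b where ab: "a < b" "line_edges P x = {a..<b}"
      using nested_cells_line_edges[OF P x] .
    then show ?thesis unfolding vertices_column ab(2) interval_Un_Suc[OF ab(1)] by simp
  qed
  have "?c p = Suc (num_rows P)"
    using p(3) nested_cells_snd[OF P] by (simp add: num_rows_def)
  \<comment> \<open>The lines are cut after \<open>p\<close>; the second half is reached from its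
    columns by \<open>Suc\<close>. Column \<open>p\<close> serves in both halves, and its occurrence
    in the first becomes the added element.\<close>
  have split: "{?l..?r} = {?l..p} \<union> Suc ` {p..<?r}" "{?l..p} = insert p {?l..<p}"
    "{?l..<?r} = {?l..<p} \<union> {p..<?r}"
    using p(1,2) by auto
  have "image_mset ?d (mset_set {?l..?r}) =
    image_mset ?d (mset_set {?l..p}) + image_mset ?d (mset_set (Suc ` {p..<?r}))"
    unfolding split(1) by (subst mset_set_Union) auto
  also have "image_mset ?d (mset_set {?l..p}) = image_mset ?c (mset_set {?l..p})"
    using p(2) by (intro image_mset_cong) (simp add: d p(4))
  also have "\<dots> = add_mset (Suc (num_rows P)) (image_mset ?c (mset_set {?l..<p}))"
    unfolding split(2) using \<open>?c p = _\<close> by simp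
  also have "image_mset ?d (mset_set (Suc ` {p..<?r})) = image_mset (\<lambda>x. ?d (Suc x)) (mset_set {p..<?r})"
    by (subst image_mset_mset_set[symmetric]) (simp_all add: multiset.map_comp o_def)
  also have "\<dots> = image_mset ?c (mset_set {p..<?r})"
    using p(1) by (intro image_mset_cong) (simp add: d p(5))
  finally show ?thesis unfolding split(3) by (subst mset_set_Union) auto
qed

section \<open>Projections as lists of column and row sizes\<close>

lemma card_col: "card (col P j) = card {y. (x, y) \<in> P}" if "x + 1 = box_left P + j"
proof -
  have "fst C + 1 = box_left P + j \<longleftrightarrow> fst C = x" for C :: point using that by arith
  then have "col P j = {C \<in> P. fst C = x}" unfolding col_def by (simp only:)
  also have "\<dots> = Pair x ` {y. (x, y) \<in> P}" by force
  finally show ?thesis by (simp add: card_image inj_on_def)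
qed

lemma card_row: "card (row P i) = card {x. (x, y) \<in> P}" if "y + i = box_top P"
proof -
  have "snd C + i = box_top P \<longleftrightarrow> snd C = y" for C :: point using that by arith
  then have "row P i = {C \<in> P. snd C = y}" unfolding row_def by (simp only:)
  also have "\<dots> = (\<lambda>x. (x, y)) ` {x. (x, y) \<in> P}" by force
  finally show ?thesis by (simp add: card_image inj_on_def)
qed

lemma length_projections [simp]:
  "length (horizontal_projections P) = num_rows P" "length (vertical_projections P) = num_cols P"
  by (simp_all add: horizontal_projections_def vertical_projections_def del: upt_Suc)

lemma nth_projections:
  "k < num_rows P \<Longrightarrow> horizontal_projections P ! k = card (row P (Suc k))"
  "k < num_cols P \<Longrightarrow> vertical_projections P ! k = card (col P (Suc k))"
  by (simp_all add: horizontal_projections_def vertical_projections_def del: upt_Suc)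

lemma vertical_projections_eq:
  assumes "box_left P \<le> box_right P"
  shows "vertical_projections P = map (\<lambda>x. card (P `` {x})) [box_left P..<box_right P]"
proof (rule nth_equalityI)
  fix k assume "k < length (vertical_projections P)"
  then have "k < num_cols P" by simp
  with assms show "vertical_projections P ! k =
      map (\<lambda>x. card (P `` {x})) [box_left P..<box_right P] ! k"
    by (simp add: nth_projections(2) num_cols_def card_col[where x = "box_left P + k"] Image_singleton)
qed (simp add: num_cols_def)

text \<open>Rows are numbered downwards while heights grow upwards, hence \<open>rev\<close>. A cell
  is named by its lower corner, so list position \<open>k\<close> has height
  \<open>box_top P - Suc k\<close>.\<close>

lemma horizontal_projections_eq:
  assumes "box_bottom P \<le> box_top P"
  shows "horizontal_projections P = rev (map (\<lambda>y. card (P\<inverse> `` {y})) [box_bottom P..<box_top P])"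
proof (rule nth_equalityI)
  fix k assume "k < length (horizontal_projections P)"
  then have k: "k < num_rows P" by simp
  have "[box_bottom P..<box_top P] ! (num_rows P - Suc k) = box_top P - Suc k"
    using k by (simp add: num_rows_def)
  with k show "horizontal_projections P ! k =
      rev (map (\<lambda>y. card (P\<inverse> `` {y})) [box_bottom P..<box_top P]) ! k"
    by (simp add: nth_projections(1) rev_nth num_rows_def Image_singleton
        card_row[where y = "box_top P - Suc k"])
qed (simp add: num_rows_def)

lemma mset_left_degrees:
  assumes P: "nested_cells P"
  shows "image_mset (\<lambda>i. card (vertices P `` {box_left P + i})) (mset_set {0..num_cols P}) =
    add_mset (Suc (num_rows P)) (image_mset Suc (mset (vertical_projections P)))"
proof -
  have lr: "box_left P \<le> box_right P" using nested_cells_fst(2)[OF P] by simp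
  then have "{box_left P..box_right P} = (+) (box_left P) ` {0..num_cols P}"
    by (simp add: num_cols_def)
  then have "image_mset ((+) (box_left P)) (mset_set {0..num_cols P}) = mset_set {box_left P..box_right P}"
    by (subst image_mset_mset_set) auto
  then have "image_mset (\<lambda>i. card (vertices P `` {box_left P + i})) (mset_set {0..num_cols P}) =
      image_mset (\<lambda>x. card (vertices P `` {x})) (mset_set {box_left P..box_right P})"
    by (metis (no_types, lifting) multiset.map_comp comp_apply image_mset_cong)
  also note mset_column_degrees[OF P]
  finally show ?thesis
    by (simp add: vertical_projections_eq[OF lr] multiset.map_comp o_def flip: mset_upt)
qed

text \<open>The count for vertical lines is applied to \<open>P\<inverse>\<close>; renumbering from
  the top reverses the order, which a multiset does not record.\<close>

lemma mset_right_degrees: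
  assumes P: "nested_cells P"
  shows "image_mset (\<lambda>j. card ((vertices P)\<inverse> `` {box_top P - j})) (mset_set {0..num_rows P}) =
    add_mset (Suc (num_cols P)) (image_mset Suc (mset (horizontal_projections P)))"
proof -
  have bt: "box_bottom P \<le> box_top P" using nested_cells_snd(2)[OF P] by simp
  have "x \<in> (-) (box_top P) ` {0..num_rows P}" if "x \<in> {box_bottom P..box_top P}" for x
    using that by (intro image_eqI[of _ _ "box_top P - x"]) (auto simp: num_rows_def)
  then have "{box_bottom P..box_top P} = (-) (box_top P) ` {0..num_rows P}"
    using bt by (auto simp: num_rows_def)
  then have "image_mset ((-) (box_top P)) (mset_set {0..num_rows P}) = mset_set {box_bottom P..box_top P}"
    by (subst image_mset_mset_set) (auto simp: inj_on_def num_rows_def)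
  then have "image_mset (\<lambda>j. card ((vertices P)\<inverse> `` {box_top P - j})) (mset_set {0..num_rows P}) =
      image_mset (\<lambda>y. card ((vertices P)\<inverse> `` {y})) (mset_set {box_bottom P..box_top P})"
    by (metis (no_types, lifting) multiset.map_comp comp_apply image_mset_cong)
  also have "\<dots> = add_mset (Suc (num_cols P))
      (image_mset (\<lambda>y. Suc (card (P\<inverse> `` {y}))) (mset_set {box_bottom P..<box_top P}))"
    using mset_column_degrees[of "P\<inverse>"] P by simp
  finally show ?thesis
    by (simp add: horizontal_projections_eq[OF bt] multiset.map_comp o_def flip: mset_upt)
qed

section \<open>Isomorphism of nested bipartite graphs\<close>

text \<open>A right vertex adjacent to \<open>i\<close> is adjacent to all left vertices of at least the degree of \<open>i\<close>;
  one not adjacent to \<open>i\<close> is adjacent only to left vertices of strictly larger degree.\<close>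

lemma nested_graph_edge_iff:
  assumes fin: "finite L" "finite R" and ij: "i \<in> L" "j \<in> R"
    and cross: "\<And>i j i' j'. E i j \<Longrightarrow> E i' j' \<Longrightarrow> E i j' \<or> E i' j"
  shows "E i j \<longleftrightarrow>
    card {i' \<in> L. card {j \<in> R. E i j} < card {j \<in> R. E i' j}} < card {i' \<in> L. E i' j}"
    (is "_ \<longleftrightarrow> card ?A < card ?B")
proof
  assume e: "E i j"
  have "?A \<subseteq> ?B"
  proof safe
    fix i' assume "i' \<in> L" and less: "card {j \<in> R. E i j} < card {j \<in> R. E i' j}"
    have "\<not> {j \<in> R. E i' j} \<subseteq> {j \<in> R. E i j}"
      using less fin card_mono[of "{j \<in> R. E i j}" "{j \<in> R. E i' j}"] by auto
    then obtain j' where "E i' j'" "\<not> E i j'" by blast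
    then show "E i' j" using cross[OF e] by blast
  qed
  moreover have "i \<in> ?B" "i \<notin> ?A" using e ij by auto
  ultimately show "card ?A < card ?B" using fin by (intro psubset_card_mono) auto
next
  assume less: "card ?A < card ?B"
  show "E i j"
  proof (rule ccontr)
    assume ne: "\<not> E i j"
    have "?B \<subseteq> ?A"
    proof safe
      fix i' assume "i' \<in> L" "E i' j"
      then have "{j \<in> R. E i j} \<subset> {j \<in> R. E i' j}" using ne ij cross by blast
      then show "card {j \<in> R. E i j} < card {j \<in> R. E i' j}" using fin by (intro psubset_card_mono) auto
    qed
    then show False using less fin card_mono[of ?A ?B] by auto
  qed
qed

text \<open>Equal degree multisets give degree-preserving permutations of both sides. Any such pair
  works, because adjacency is determined by the degrees through
  \<open>nested_graph_edge_iff\<close>.\<close>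

lemma nested_graphs_isomorphic:
  assumes fin: "finite L" "finite R"
    and cross: "\<And>i j i' j'. E i j \<Longrightarrow> E i' j' \<Longrightarrow> E i j' \<or> E i' j"
    and cross': "\<And>i j i' j'. E' i j \<Longrightarrow> E' i' j' \<Longrightarrow> E' i j' \<or> E' i' j"
    and left: "image_mset (\<lambda>i. card {j \<in> R. E i j}) (mset_set L) =
      image_mset (\<lambda>i. card {j \<in> R. E' i j}) (mset_set L)"
    and right: "image_mset (\<lambda>j. card {i \<in> L. E i j}) (mset_set R) =
      image_mset (\<lambda>j. card {i \<in> L. E' i j}) (mset_set R)"
  obtains f g where "f permutes L" "g permutes R"
    "\<And>i j. i \<in> L \<Longrightarrow> j \<in> R \<Longrightarrow> E i j \<longleftrightarrow> E' (f i) (g j)"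
proof -
  obtain f where f: "f permutes L" "\<And>i. i \<in> L \<Longrightarrow> card {j \<in> R. E i j} = card {j \<in> R. E' (f i) j}"
    using image_mset_eq_implies_permutes[OF fin(1) left] by metis
  obtain g where g: "g permutes R" "\<And>j. j \<in> R \<Longrightarrow> card {i \<in> L. E i j} = card {i \<in> L. E' i (g j)}"
    using image_mset_eq_implies_permutes[OF fin(2) right] by metis
  have "E i j \<longleftrightarrow> E' (f i) (g j)" if ij: "i \<in> L" "j \<in> R" for i j
  proof -
    \<comment> \<open>Preserving degrees, \<open>f\<close> carries the vertices of larger degree
      than \<open>i\<close> to those of larger degree than \<open>f i\<close>.\<close>
    have "{i' \<in> L. card {j \<in> R. E' (f i) j} < card {j \<in> R. E' i' j}} =
        f ` {i' \<in> L. card {j \<in> R. E i j} < card {j \<in> R. E i' j}}"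
      (is "?A' = f ` ?A")
    proof -
      have "?A' = {i' \<in> f ` L. card {j \<in> R. E' (f i) j} < card {j \<in> R. E' i' j}}"
        using permutes_image[OF f(1)] by simp
      also have "\<dots> = f ` ?A" using f(2) ij(1) by auto
      finally show ?thesis .
    qed
    then have "card ?A' = card ?A"
      by (simp add: card_image permutes_inj_on[OF f(1)])
    moreover have "f i \<in> L" "g j \<in> R" using ij f(1) g(1) by (simp_all add: permutes_in_image)
    ultimately show ?thesis
      using nested_graph_edge_iff[where E = E, OF fin ij cross] g(2)[OF ij(2)]
        nested_graph_edge_iff[where E = E' and i = "f i" and j = "g j", OF fin _ _ cross']
      by simp
  qed
  with f(1) g(1) that show ?thesis by blast
qed

text \<open>The sizes of the projection multisets give the box dimensions, so both graphs have the
  same vertices; the entries give the degrees.\<close>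

lemma polyomino_graph_isomorphicI:
  assumes P: "nested_cells P" and Q: "nested_cells Q"
    and H: "mset (horizontal_projections Q) = mset (horizontal_projections P)"
    and V: "mset (vertical_projections Q) = mset (vertical_projections P)"
  shows "bipartite_graph_isomorphic (polyomino_graph P) (polyomino_graph Q)"
proof -
  have rows: "num_rows Q = num_rows P"
    using arg_cong[OF H, of size] by simp
  have cols: "num_cols Q = num_cols P"
    using arg_cong[OF V, of size] by simp
  \<comment> \<open>Adjacency in coordinates: the crossing point of lines \<open>i\<close> and
    \<open>j\<close> is a vertex of a cell.\<close>
  define E where "E P i j \<longleftrightarrow> (box_left P + i, box_top P - j) \<in> vertices P" for P i j
  let ?L = "{0..num_cols P}" and ?R = "{0..num_rows P}"
  \<comment> \<open>Neighbours correspond to vertices on the line by subtraction from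
    \<open>box_top P\<close>, which is its own inverse inside the box.\<close>
  have left: "card {j \<in> {0..num_rows P}. E P i j} = card (vertices P `` {box_left P + i})"
    if P: "nested_cells P" for P i
  proof (rule bij_betw_same_card[of "(-) (box_top P)"])
    have "y \<in> snd ` vertices P" if "(x, y) \<in> vertices P" for x y using that by force
    moreover have "snd ` vertices P = {box_bottom P..box_top P}"
      using fst_vertices[of "P\<inverse>"] nested_cells_snd[OF P]
      by (simp add: fst_converse interval_Un_Suc del: image_Suc_atLeastLessThan)
    ultimately have *: "box_bottom P \<le> y" "y \<le> box_top P" if "(x, y) \<in> vertices P" for x y
      using that by auto
    show "bij_betw ((-) (box_top P)) {j \<in> {0..num_rows P}. E P i j} (vertices P `` {box_left P + i})"
      by (rule bij_betw_byWitness[where f' = "(-) (box_top P)"])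
        (use nested_cells_snd(2)[OF P] in \<open>auto simp: E_def num_rows_def diff_le_mono2 *\<close>)
  qed
  have right: "card {i \<in> {0..num_cols P}. E P i j} = card ((vertices P)\<inverse> `` {box_top P - j})"
    if P: "nested_cells P" for P j
  proof (rule bij_betw_same_card[of "(+) (box_left P)"])
    have "x \<in> fst ` vertices P" if "(x, y) \<in> vertices P" for x y using that by force
    moreover have "fst ` vertices P = {box_left P..box_right P}"
      using fst_vertices[of P] nested_cells_fst[OF P]
      by (simp add: interval_Un_Suc del: image_Suc_atLeastLessThan)
    ultimately have *: "box_left P \<le> x" "x \<le> box_right P" if "(x, y) \<in> vertices P" for x y
      using that by auto
    show "bij_betw ((+) (box_left P)) {i \<in> {0..num_cols P}. E P i j} ((vertices P)\<inverse> `` {box_top P - j})"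
      by (rule bij_betw_byWitness[where f' = "\<lambda>x. x - box_left P"])
        (auto simp: E_def num_cols_def diff_le_mono *)
  qed
  obtain f g where f: "f permutes ?L" and g: "g permutes ?R"
    and fg: "\<And>i j. i \<in> ?L \<Longrightarrow> j \<in> ?R \<Longrightarrow> E P i j \<longleftrightarrow> E Q (f i) (g j)"
  proof (rule nested_graphs_isomorphic[of ?L ?R "E P" "E Q"])
    show "image_mset (\<lambda>i. card {j \<in> ?R. E P i j}) (mset_set ?L) =
        image_mset (\<lambda>i. card {j \<in> ?R. E Q i j}) (mset_set ?L)"
      using mset_left_degrees[OF P] mset_left_degrees[OF Q] left[OF P] left[OF Q] rows cols V by simp
    show "image_mset (\<lambda>j. card {i \<in> ?L. E P i j}) (mset_set ?R) =
        image_mset (\<lambda>j. card {i \<in> ?L. E Q i j}) (mset_set ?R)"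
      using mset_right_degrees[OF P] mset_right_degrees[OF Q] right[OF P] right[OF Q] rows cols H by simp
    show "E P i j' \<or> E P i' j" if "E P i j" "E P i' j'" for i j i' j'
      using nested_cells_vertices_cross[OF P] that unfolding E_def by blast
    show "E Q i j' \<or> E Q i' j" if "E Q i j" "E Q i' j'" for i j i' j'
      using nested_cells_vertices_cross[OF Q] that unfolding E_def by blast
    show "finite ?L" "finite ?R" by simp_all
  qed (use that in blast)
  \<comment> \<open>Acting separately on the two summands makes \<open>h\<close> respect the two
    parts.\<close>
  define h where "h = map_sum f g"
  have "h ` Inl ` ?L = Inl ` f ` ?L" "h ` Inr ` ?R = Inr ` g ` ?R"
    by (simp_all add: h_def image_image)
  then have im: "h ` Inl ` ?L = Inl ` ?L" "h ` Inr ` ?R = Inr ` ?R"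
    using permutes_image[OF f] permutes_image[OF g] by simp_all
  have "inj h" unfolding h_def using permutes_inj[OF f] permutes_inj[OF g] by (rule sum.inj_map)
  then have bij: "bij_betw h (Inl ` ?L \<union> Inr ` ?R) (Inl ` ?L \<union> Inr ` ?R)"
    using im by (simp add: bij_betw_def image_Un inj_on_subset[OF _ subset_UNIV])
  have edges: "edges (polyomino_graph S) =
      {{Inl i, Inr j} | i j. i \<le> num_cols S \<and> j \<le> num_rows S \<and> E S i j}" if "nested_cells S" for S
    using V_H_intersect_iff[OF that] by (simp add: polyomino_graph_def E_def cong: conj_cong)
  \<comment> \<open>Permutations preserve the index ranges, so the bounds in the edge sets
    match.\<close>
  have mem: "f i \<le> num_cols P \<longleftrightarrow> i \<le> num_cols P" "g j \<le> num_rows P \<longleftrightarrow> j \<le> num_rows P" for i j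
    using permutes_in_image[OF f, of i] permutes_in_image[OF g, of j] by simp_all
  have "{u, v} \<in> edges (polyomino_graph P) \<longleftrightarrow> {h u, h v} \<in> edges (polyomino_graph Q)"
    if "u \<in> Inl ` ?L \<union> Inr ` ?R" "v \<in> Inl ` ?L \<union> Inr ` ?R" for u v
    using that unfolding edges[OF P] edges[OF Q] rows cols h_def
    by (auto simp: doubleton_eq_iff mem fg)
  with bij im show ?thesis
    unfolding bipartite_graph_isomorphic_def
    by (intro exI[of _ h]) (simp add: polyomino_graph_def rows cols)
qed

section \<open>\<open>L\<close>-convex polyominoes are nested\<close>

lemma share_edge_aligned: "share_edge C D \<Longrightarrow> fst C = fst D \<or> snd C = snd D"
  by (cases C; cases D) (auto simp: share_edge_def doubleton_eq_iff)

text \<open>Induction on the end. Without a turn at \<open>j\<close>, its two neighbours in the list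
  agree in a coordinate; since the cell before \<open>j\<close> differs from cell \<open>j\<close>,
  the new cell must keep the coordinate held constant so far.\<close>

lemma straight_segment:
  assumes "distinct Cs" "successively share_edge Cs"
    and "i \<le> j" "j < length Cs" "\<And>k. i < k \<Longrightarrow> k < j \<Longrightarrow> k \<notin> changes_of_direction Cs"
  shows "(\<forall>k\<in>{i..j}. fst (Cs ! k) = fst (Cs ! i)) \<or> (\<forall>k\<in>{i..j}. snd (Cs ! k) = snd (Cs ! i))"
  using assms(3-5)
proof (induction j rule: dec_induct)
  case base
  then show ?case by simp
next
  case (step j)
  have aligned: "fst (Cs ! j) = fst (Cs ! Suc j) \<or> snd (Cs ! j) = snd (Cs ! Suc j)"
    using assms(2) step.prems(1) by (intro share_edge_aligned) (simp add: successively_conv_nth)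
  have IH: "(\<forall>k\<in>{i..j}. fst (Cs ! k) = fst (Cs ! i)) \<or> (\<forall>k\<in>{i..j}. snd (Cs ! k) = snd (Cs ! i))"
    by (rule step.IH) (simp_all add: step.prems Suc_lessD[OF step.prems(1)])
  have Icc: "{i..Suc j} = insert (Suc j) {i..j}" using step.hyps by auto
  show ?case
  \<comment> \<open>For \<open>i = j\<close> no earlier cell fixes a direction; the edge shared by
    the two cells suffices.\<close>
  proof (cases "i = j")
    case True
    then have "{i..Suc j} = {j, Suc j}" by auto
    then show ?thesis using aligned True by auto
  next
    case False
    then obtain l where l: "j = Suc l" "i \<le> l" using step.hyps by (cases j) auto
    have turn: "fst (Cs ! l) = fst (Cs ! Suc j) \<or> snd (Cs ! l) = snd (Cs ! Suc j)"
      using step.prems(2)[of j] step.prems(1) l by (auto simp: changes_of_direction_def)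
    have ne: "Cs ! l \<noteq> Cs ! j"
      using assms(1) step.prems(1) l by (simp add: nth_eq_iff_index_eq)
    have mem: "l \<in> {i..j}" "j \<in> {i..j}" using l by auto
    from IH show ?thesis
    proof
      assume same: "\<forall>k\<in>{i..j}. fst (Cs ! k) = fst (Cs ! i)"
      with mem have "fst (Cs ! l) = fst (Cs ! i)" "fst (Cs ! j) = fst (Cs ! i)" by blast+
      with turn ne aligned have "fst (Cs ! Suc j) = fst (Cs ! i)" by (metis prod_eqI)
      with same show ?thesis unfolding Icc by blast
    next
      assume same: "\<forall>k\<in>{i..j}. snd (Cs ! k) = snd (Cs ! i)"
      with mem have "snd (Cs ! l) = snd (Cs ! i)" "snd (Cs ! j) = snd (Cs ! i)" by blast+
      with turn ne aligned have "snd (Cs ! Suc j) = snd (Cs ! i)" by (metis prod_eqI)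
      with same show ?thesis unfolding Icc by blast
    qed
  qed
qed

text \<open>The cell at which the path turns is the corner \<open>(x, y')\<close> or \<open>(x', y)\<close>.\<close>

lemma L_path_corner:
  assumes path: "cell_path P (x, y) (x', y') Cs" and card: "card (changes_of_direction Cs) \<le> 1"
  shows "(x, y') \<in> P \<or> (x', y) \<in> P"
proof -
  define q where "q = length Cs - 1"
  from path have Cs: "distinct Cs" "successively share_edge Cs" "set Cs \<subseteq> P" and q: "q < length Cs"
    "Cs ! 0 = (x, y)" "Cs ! q = (x', y')"
    by (auto simp: cell_path_def cell_sequence_def q_def hd_conv_nth last_conv_nth)
  have fin: "finite (changes_of_direction Cs)"
    by (rule finite_subset[of _ "{..<length Cs}"]) (auto simp: changes_of_direction_def)
  \<comment> \<open>If the path never turns, \<open>k = 0\<close> serves, the first segment being a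
    single cell.\<close>
  obtain k where k: "k \<le> q" "changes_of_direction Cs \<subseteq> {k}"
  proof (cases "changes_of_direction Cs = {}")
    case False
    with card fin have "card (changes_of_direction Cs) = 1" by (simp add: le_Suc_eq)
    then obtain k where k: "changes_of_direction Cs = {k}" by (auto simp: card_1_singleton_iff)
    then have "k \<in> changes_of_direction Cs" by simp
    then have "k \<le> q" by (auto simp: changes_of_direction_def q_def)
    with k that show ?thesis by simp
  next
    case True
    with that[of 0] show ?thesis by simp
  qed
  have segment_ends: "fst (Cs ! j) = fst (Cs ! i) \<or> snd (Cs ! j) = snd (Cs ! i)"
    if "i \<le> j" "j \<le> q" "\<And>l. i < l \<Longrightarrow> l < j \<Longrightarrow> l \<notin> changes_of_direction Cs" for i j
  proof -
    have "j < length Cs" "j \<in> {i..j}" using that(1,2) q(1) by auto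
    with straight_segment[OF Cs(1,2) that(1) _ that(3)] show ?thesis by blast
  qed
  have "fst (Cs ! k) = x \<or> snd (Cs ! k) = y"
    using segment_ends[of 0 k] k q by auto
  moreover have "x' = fst (Cs ! k) \<or> y' = snd (Cs ! k)"
    using segment_ends[of k q] k q by auto
  moreover have "Cs ! i \<in> P" if "i \<le> q" for i
    using Cs(3) nth_mem[of i Cs] q(1) that by auto
  from this[of 0] this[of k] this[of q] have "(x, y) \<in> P" "(fst (Cs ! k), snd (Cs ! k)) \<in> P" "(x', y') \<in> P"
    using k q by simp_all
  \<comment> \<open>If both segments run in the same direction, the end cells share a row or column
    and are themselves the required corners.\<close>
  ultimately show ?thesis by auto
qed

lemma L_convex_nested:
  assumes "L_convex P"
  shows "nested_cells P"
proof -
  have convex: "convex_polyomino P" using assms by (simp add: L_convex_def)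
  have cross: "\<forall>x y x' y'. (x, y) \<in> P \<and> (x', y') \<in> P \<longrightarrow> (x, y') \<in> P \<or> (x', y) \<in> P"
  proof (intro allI impI, elim conjE)
    fix x y x' y' assume "(x, y) \<in> P" "(x', y') \<in> P"
    with assms obtain Cs where "cell_path P (x, y) (x', y') Cs" "card (changes_of_direction Cs) \<le> 1"
      unfolding L_convex_def by meson
    then show "(x, y') \<in> P \<or> (x', y) \<in> P" by (rule L_path_corner)
  qed
  show ?thesis
    unfolding nested_cells_def
    by (insert convex[unfolded convex_polyomino_def polyomino_def] cross, elim conjE,
        (intro conjI; assumption))
qed

section \<open>Ferrer diagrams\<close>

lemma finite_cell_in_box:
  assumes "finite P" "(x, y) \<in> P"
  shows "box_left P \<le> x" "y < box_top P"
proof -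
  have "(x, y) \<in> vertices P" "(x, Suc y) \<in> vertices P" using assms(2) by (auto simp: vertices_iff)
  then have "x \<in> fst ` vertices P" "Suc y \<in> snd ` vertices P" by force+
  then show "box_left P \<le> x" "y < box_top P"
    using finite_vertices[OF assms(1)] by (simp_all add: box_left_def box_top_def Suc_le_eq[symmetric])
qed

text \<open>The definition in coordinates: smaller row numbers mean larger heights, so a Ferrer
  diagram is closed to the left and upwards within its box.\<close>

lemma ferrer_diagram_iff:
  "ferrer_diagram P \<longleftrightarrow> polyomino P \<and>
    (\<forall>x y x' y'. (x, y) \<in> P \<and> box_left P \<le> x' \<and> x' \<le> x \<and> y \<le> y' \<and> y' < box_top P \<longrightarrow> (x', y') \<in> P)"
proof (cases "polyomino P")
  case True
  then have fin: "finite P" by (simp add: polyomino_def)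
  have meet: "row P i \<inter> col P j \<noteq> {} \<longleftrightarrow>
    (\<exists>x y. (x, y) \<in> P \<and> y + i = box_top P \<and> x + 1 = box_left P + j)" for i j
    by (auto simp: row_def col_def)
  show ?thesis
  proof
    assume F: "ferrer_diagram P"
    show "polyomino P \<and>
      (\<forall>x y x' y'. (x, y) \<in> P \<and> box_left P \<le> x' \<and> x' \<le> x \<and> y \<le> y' \<and> y' < box_top P \<longrightarrow> (x', y') \<in> P)"
    proof (intro conjI True allI impI, elim conjE)
      fix x y x' y' assume a: "(x, y) \<in> P" "box_left P \<le> x'" "x' \<le> x" "y \<le> y'" "y' < box_top P"
      note box = finite_cell_in_box[OF fin a(1)]
      \<comment> \<open>These are the row and column numbers of \<open>(x, y)\<close>; the bounds in
        \<open>box\<close> make both subtractions exact.\<close>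
      have "row P (box_top P - y) \<inter> col P (Suc x - box_left P) \<noteq> {}"
        unfolding meet using a(1) box by (intro exI[of _ x] exI[of _ y]) auto
      moreover have "1 \<le> box_top P - y'" "box_top P - y' \<le> box_top P - y"
        "1 \<le> Suc x' - box_left P" "Suc x' - box_left P \<le> Suc x - box_left P"
        using a by auto
      ultimately have "row P (box_top P - y') \<inter> col P (Suc x' - box_left P) \<noteq> {}"
        using F unfolding ferrer_diagram_def by blast
      then obtain u v where "(u, v) \<in> P" "v + (box_top P - y') = box_top P"
        "u + 1 = box_left P + (Suc x' - box_left P)" unfolding meet by blast
      moreover from this a have "u = x'" "v = y'" by auto
      ultimately show "(x', y') \<in> P" by simp
    qed
  next
    assume R: "polyomino P \<and>
      (\<forall>x y x' y'. (x, y) \<in> P \<and> box_left P \<le> x' \<and> x' \<le> x \<and> y \<le> y' \<and> y' < box_top P \<longrightarrow> (x', y') \<in> P)"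
    show "ferrer_diagram P"
      unfolding ferrer_diagram_def
    proof (intro conjI True allI impI, elim conjE)
      fix i j s r assume a: "row P i \<inter> col P j \<noteq> {}" "1 \<le> s" "s \<le> i" "1 \<le> r" "r \<le> j"
      from a(1) obtain x y where xy: "(x, y) \<in> P" "y + i = box_top P" "x + 1 = box_left P + j"
        unfolding meet by blast
      then have "(box_left P + r - 1, box_top P - s) \<in> P"
        using a by (intro R[THEN conjunct2, rule_format, of x y]) auto
      moreover have "box_top P - s + s = box_top P" "box_left P + r - 1 + 1 = box_left P + r"
        using a xy by auto
      ultimately show "row P s \<inter> col P r \<noteq> {}" unfolding meet by blast
    qed
  qed
qed (simp add: ferrer_diagram_def)

text \<open>Crossing follows from closure to the left: if \<open>x \<le> x'\<close> then
  \<open>(x, y')\<close> lies left of \<open>(x', y')\<close>, otherwise \<open>(x', y)\<close> lies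
  left of \<open>(x, y)\<close>.\<close>

lemma ferrer_diagram_nested:
  assumes "ferrer_diagram P"
  shows "nested_cells P"
proof -
  have fin: "finite P" "P \<noteq> {}"
    and down: "\<And>x y x' y'. (x, y) \<in> P \<Longrightarrow> box_left P \<le> x' \<Longrightarrow> x' \<le> x \<Longrightarrow> y \<le> y' \<Longrightarrow> y' < box_top P \<Longrightarrow> (x', y') \<in> P"
    using assms unfolding ferrer_diagram_iff polyomino_def by blast+
  note box = finite_cell_in_box[OF fin(1)]
  show ?thesis
    unfolding nested_cells_def
  proof (intro conjI fin allI impI; elim conjE)
    show "(k, j) \<in> P" if "(i, j) \<in> P" "(i', j) \<in> P" "i \<le> k" "k \<le> i'" for i k i' j
      using down[OF that(2) _ that(4) order_refl] box(1)[OF that(1)] box(2)[OF that(2)] that(3) by simp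
    show "(i, k) \<in> P" if "(i, j) \<in> P" "(i, j') \<in> P" "j \<le> k" "k \<le> j'" for i j k j'
      using down[OF that(1) _ order_refl that(3)] box(1)[OF that(1)] box(2)[OF that(2)] that(4) by simp
    show "(x, y') \<in> P \<or> (x', y) \<in> P" if "(x, y) \<in> P" "(x', y') \<in> P" for x y x' y'
      using down[OF that(1), of x' y] down[OF that(2), of x y'] box[OF that(1)] box[OF that(2)]
      by (cases "x \<le> x'") auto
  qed
qed

lemma down_closed_nat_eq_lessThan:
  fixes A :: "nat set"
  assumes "finite A" "\<And>x y. x \<in> A \<Longrightarrow> y \<le> x \<Longrightarrow> y \<in> A"
  shows "A = {..<card A}"
proof (cases "A = {}")
  case False
  define a where "a = Max A"
  have "a \<in> A" "\<And>x. x \<in> A \<Longrightarrow> x \<le> a" using assms(1) False by (simp_all add: a_def)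
  with assms(2) have A: "A = {..a}" by blast
  show ?thesis unfolding A by (simp add: lessThan_Suc_atMost)
qed simp

text \<open>Each row is an initial segment of the naturals, hence known from its length. This gives
  the uniqueness of the projected diagram.\<close>

lemma ferrer_diagram_determined:
  assumes F: "ferrer_diagram Q" and box: "box_left Q = 0" "box_bottom Q = 0"
  shows "Q = {(x, y). y < length (horizontal_projections Q) \<and>
    x < rev (horizontal_projections Q) ! y}"
proof -
  have fin: "finite Q" using F unfolding ferrer_diagram_iff polyomino_def by blast
  have rows: "num_rows Q = box_top Q"
    by (simp add: num_rows_def box)
  have "Q\<inverse> `` {y} = {..<card (Q\<inverse> `` {y})}" for y
  proof (rule down_closed_nat_eq_lessThan)
    show "finite (Q\<inverse> `` {y})" using fin by (simp add: finite_Image)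
    show "x' \<in> Q\<inverse> `` {y}" if "x \<in> Q\<inverse> `` {y}" "x' \<le> x" for x x'
      using that F finite_cell_in_box(2)[OF fin, of x y] unfolding ferrer_diagram_iff box(1) by auto
  qed
  then have "(x, y) \<in> Q \<longleftrightarrow> x < card (Q\<inverse> `` {y})" for x y by auto
  moreover have "rev (horizontal_projections Q) ! y = card (Q\<inverse> `` {y})" if "y < box_top Q" for y
    using that by (simp add: horizontal_projections_eq box)
  ultimately show ?thesis using finite_cell_in_box(2)[OF fin] by (auto simp: rows)
qed

section \<open>Connectedness of sets closed to the left and upwards\<close>

lemma cell_sequence_refl: "C \<in> P \<Longrightarrow> \<exists>Cs. cell_sequence P C C Cs"
  by (intro exI[of _ "[C]"]) (simp add: cell_sequence_def)

lemma share_edge_refl: "share_edge C C"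
  by (cases C) (simp add: share_edge_def)

text \<open>The cell \<open>B\<close> is listed twice at the junction, which is allowed because a
  cell shares an edge with itself and sequences need not be distinct.\<close>

lemma cell_sequence_trans:
  assumes "cell_sequence P A B Cs" "cell_sequence P B C Ds"
  shows "cell_sequence P A C (Cs @ Ds)"
  using assms by (simp add: cell_sequence_def successively_append_iff share_edge_refl)

lemma cell_sequence_rev:
  assumes "cell_sequence P A B Cs"
  shows "cell_sequence P B A (rev Cs)"
proof -
  have "(\<lambda>x y. share_edge y x) = share_edge" by (auto simp: share_edge_def Int_commute fun_eq_iff)
  then have "successively share_edge (rev Cs) = successively share_edge Cs"
    unfolding successively_rev by (rule arg_cong)
  with assms show ?thesis by (simp add: cell_sequence_def hd_rev last_rev del: successively_rev)
qed

lemma cell_sequence_neighbour: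
  assumes "(x, y) \<in> P" "(x', y') \<in> P" "x' = Suc x \<and> y' = y \<or> x' = x \<and> y' = Suc y"
  shows "cell_sequence P (x, y) (x', y') [(x, y), (x', y')]"
proof -
  have "{(Suc x, y), (Suc x, Suc y)} \<in> cell_edges (x, y) \<inter> cell_edges (Suc x, y)"
    "{(x, Suc y), (Suc x, Suc y)} \<in> cell_edges (x, y) \<inter> cell_edges (x, Suc y)" by simp_all
  then have "share_edge (x, y) (x', y')" using assms(3) unfolding share_edge_def by blast
  with assms(1,2) show ?thesis by (simp add: cell_sequence_def)
qed

text \<open>From every cell one can go left to column 0 and then up to the corner
  \<open>(0, n - 1)\<close>; any two cells are joined through that corner.\<close>

lemma polyomino_of_down_closed:
  fixes Q :: "point set"
  assumes fin: "finite Q" "Q \<noteq> {}" and top: "\<And>x y. (x, y) \<in> Q \<Longrightarrow> y < n"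
    and down: "\<And>x y x' y'. (x, y) \<in> Q \<Longrightarrow> x' \<le> x \<Longrightarrow> y \<le> y' \<Longrightarrow> y' < n \<Longrightarrow> (x', y') \<in> Q"
  shows "polyomino Q"
proof -
  have left: "\<exists>Cs. cell_sequence Q (x, y) (0, y) Cs" if "(x, y) \<in> Q" for x y
    using that
  proof (induction x)
    case 0
    then show ?case by (rule cell_sequence_refl)
  next
    case (Suc x)
    have "(x, y) \<in> Q" using down[OF Suc.prems, of x y] top[OF Suc.prems] by simp
    with Suc show ?case
      using cell_sequence_rev[OF cell_sequence_neighbour[of x y Q "Suc x" y]] cell_sequence_trans by blast
  qed
  have up: "\<exists>Cs. cell_sequence Q (0, y) (0, n - 1) Cs" if "(0, y) \<in> Q" for y
  proof -
    have "y \<le> n - 1" using top[OF that] by simp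
    then show ?thesis
      using that
    proof (induction y rule: inc_induct)
      case base
      then show ?case by (rule cell_sequence_refl)
    next
      case (step k)
      have "(0, Suc k) \<in> Q" using down[OF step.prems, of 0 "Suc k"] step.hyps by simp
      with step show ?case
        using cell_sequence_neighbour[of 0 k Q 0 "Suc k"] cell_sequence_trans by blast
    qed
  qed
  have corner: "\<exists>Cs. cell_sequence Q C (0, n - 1) Cs" if "C \<in> Q" for C
  proof -
    obtain x y where C: "C = (x, y)" by (cases C)
    have "(0, y) \<in> Q" using down[of x y 0 y] top[of x y] that C by simp
    then show ?thesis using left[of x y] up[of y] that cell_sequence_trans unfolding C by blast
  qed
  have "\<exists>Cs. cell_sequence Q C D Cs" if CD: "C \<in> Q" "D \<in> Q" for C D
  proof -
    obtain Cs Ds where "cell_sequence Q C (0, n - 1) Cs" "cell_sequence Q D (0, n - 1) Ds"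
      using corner[OF CD(1)] corner[OF CD(2)] by blast
    then have "cell_sequence Q C D (Cs @ rev Ds)" by (intro cell_sequence_trans cell_sequence_rev)
    then show ?thesis ..
  qed
  with fin show ?thesis by (simp add: polyomino_def)
qed

text \<open>Sorting the rows and the columns of \<open>P\<close> by decreasing length gives a Ferrer diagram.\<close>

lemma projected_ferrer_diagram_exists:
  assumes P: "nested_cells P"
  shows "\<exists>Q. ferrer_diagram Q \<and> box_left Q = 0 \<and> box_bottom Q = 0 \<and>
     horizontal_projections Q = rev (sort (horizontal_projections P)) \<and>
     vertical_projections Q = rev (sort (vertical_projections P))"
proof -
  define cc where "cc x = card (P `` {x})" for x
  define rc where "rc y = card (P\<inverse> `` {y})" for y
  define xs where "xs = rev (sort_key cc [box_left P..<box_right P])"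
  define ys where "ys = rev (sort_key rc [box_bottom P..<box_top P])"
  define m where "m = length xs"
  define n where "n = length ys"
  \<comment> \<open>Both lists start with the longest line. The longest row belongs at the top,
    height \<open>n - 1\<close>, so height \<open>y\<close> receives entry
    \<open>n - Suc y\<close>.\<close>
  define Q where "Q = {(x, y). x < m \<and> y < n \<and> (xs ! x, ys ! (n - Suc y)) \<in> P}"
  have fin: "finite (P `` {x})" "finite (P\<inverse> `` {x})" for x
    using nested_cells_finite[OF P] by (simp_all add: finite_Image)
  have set: "set xs = fst ` P" "set ys = snd ` P" "distinct xs" "distinct ys"
    using nested_cells_fst(1)[OF P] nested_cells_snd(1)[OF P] by (simp_all add: xs_def ys_def)
  have mn: "0 < m" "0 < n"
    using nested_cells_fst(2)[OF P] nested_cells_snd(2)[OF P] by (simp_all add: m_def n_def xs_def ys_def)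
  have sorted: "sorted (rev (map cc xs))" "sorted (rev (map rc ys))"
    by (simp_all add: xs_def ys_def rev_map)
  \<comment> \<open>Columns are comparable by crossing, so the order by size is an order by
    inclusion.\<close>
  have mono_x: "P `` {xs ! j} \<subseteq> P `` {xs ! i}" if "i \<le> j" "j < m" for i j
  proof -
    have "cc (xs ! j) \<le> cc (xs ! i)"
      using sorted(1) that unfolding sorted_rev_iff_nth_mono by (simp add: m_def)
    moreover have "P `` {xs ! j} \<subseteq> P `` {xs ! i} \<or> P `` {xs ! i} \<subseteq> P `` {xs ! j}"
      using nested_cells_cross[OF P] by blast
    ultimately show ?thesis
      using card_seteq[OF fin(1)[of "xs ! j"], of "P `` {xs ! i}"] by (auto simp: cc_def)
  qed
  have mono_y: "P\<inverse> `` {ys ! j} \<subseteq> P\<inverse> `` {ys ! i}" if "i \<le> j" "j < n" for i j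
  proof -
    have "rc (ys ! j) \<le> rc (ys ! i)"
      using sorted(2) that unfolding sorted_rev_iff_nth_mono by (simp add: n_def)
    moreover have "P\<inverse> `` {ys ! j} \<subseteq> P\<inverse> `` {ys ! i} \<or> P\<inverse> `` {ys ! i} \<subseteq> P\<inverse> `` {ys ! j}"
      using nested_cells_cross[OF P] by blast
    ultimately show ?thesis
      using card_seteq[OF fin(2)[of "ys ! j"], of "P\<inverse> `` {ys ! i}"] by (auto simp: rc_def)
  qed
  have down: "(x', y') \<in> Q" if "(x, y) \<in> Q" "x' \<le> x" "y \<le> y'" "y' < n" for x y x' y'
    using that mono_x[of x' x] mono_y[of "n - Suc y'" "n - Suc y"] by (auto simp: Q_def diff_le_mono2)
  \<comment> \<open>Since \<open>ys\<close> lists every row exactly once, column \<open>x\<close> of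
    \<open>Q\<close> is a rearrangement of column \<open>xs ! x\<close> of \<open>P\<close>.\<close>
  have cols: "card (Q `` {x}) = cc (xs ! x)" if "x < m" for x
    unfolding cc_def
  proof (rule bij_betw_same_card[of "\<lambda>y. ys ! (n - Suc y)"], rule bij_betw_imageI)
    show "inj_on (\<lambda>y. ys ! (n - Suc y)) (Q `` {x})"
      using set(4) by (auto simp: inj_on_def Q_def n_def nth_eq_iff_index_eq)
    have "v \<in> (\<lambda>y. ys ! (n - Suc y)) ` Q `` {x}" if v: "(xs ! x, v) \<in> P" for v
    proof -
      have "v \<in> set ys" using v set(2) by force
      then obtain k where "k < n" "v = ys ! k" by (auto simp: in_set_conv_nth n_def)
      with v \<open>x < m\<close> show ?thesis by (intro image_eqI[of _ _ "n - Suc k"]) (auto simp: Q_def)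
    qed
    then show "(\<lambda>y. ys ! (n - Suc y)) ` Q `` {x} = P `` {xs ! x}" by (auto simp: Q_def)
  qed
  have rows: "card (Q\<inverse> `` {y}) = rc (ys ! (n - Suc y))" if "y < n" for y
    unfolding rc_def
  proof (rule bij_betw_same_card[of "\<lambda>x. xs ! x"], rule bij_betw_imageI)
    show "inj_on (\<lambda>x. xs ! x) (Q\<inverse> `` {y})"
      using set(3) by (auto simp: inj_on_def Q_def m_def nth_eq_iff_index_eq)
    have "u \<in> (\<lambda>x. xs ! x) ` Q\<inverse> `` {y}" if u: "(u, ys ! (n - Suc y)) \<in> P" for u
    proof -
      have "u \<in> set xs" using u set(1) by force
      then obtain k where "k < m" "u = xs ! k" by (auto simp: in_set_conv_nth m_def)
      with u \<open>y < n\<close> show ?thesis by (intro image_eqI[of _ _ k]) (auto simp: Q_def)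
    qed
    then show "(\<lambda>x. xs ! x) ` Q\<inverse> `` {y} = P\<inverse> `` {ys ! (n - Suc y)}" by (auto simp: Q_def)
  qed
  \<comment> \<open>No listed column is empty, so \<open>Q\<close> occupies all \<open>m\<close>
    columns and its box has the expected width.\<close>
  have fst_Q: "fst ` Q = {0..<m}"
  proof -
    have "x \<in> fst ` Q" if "x < m" for x
    proof -
      have "xs ! x \<in> fst ` P" using that set(1) by (auto simp: m_def)
      then have "P `` {xs ! x} \<noteq> {}" by force
      then have "card (Q `` {x}) \<noteq> 0" using fin cols[OF that] by (simp add: cc_def)
      then have "Q `` {x} \<noteq> {}" by force
      then show ?thesis by force
    qed
    then show ?thesis by (auto simp: Q_def)
  qed
  have snd_Q: "snd ` Q = {0..<n}"
  proof -
    have "y \<in> snd ` Q" if "y < n" for y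
    proof -
      have "ys ! (n - Suc y) \<in> snd ` P" using that set(2) by (auto simp: n_def)
      then have "P\<inverse> `` {ys ! (n - Suc y)} \<noteq> {}" by force
      then have "card (Q\<inverse> `` {y}) \<noteq> 0" using fin rows[OF that] by (simp add: rc_def)
      then have "Q\<inverse> `` {y} \<noteq> {}" by force
      then show ?thesis by force
    qed
    then show ?thesis by (auto simp: Q_def)
  qed
  note box = box_horizontal_eqI[OF mn(1) fst_Q] box_vertical_eqI[OF mn(2) snd_Q]
  have "polyomino Q"
  proof (rule polyomino_of_down_closed)
    show "finite Q" by (rule finite_subset[of _ "{..<m} \<times> {..<n}"]) (auto simp: Q_def)
    show "Q \<noteq> {}" using fst_Q mn by auto
  qed (use down in \<open>auto simp: Q_def\<close>)
  then have "ferrer_diagram Q" unfolding ferrer_diagram_iff box using down by blast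
  moreover have "vertical_projections Q = rev (sort (vertical_projections P))"
  proof -
    have "vertical_projections Q = map cc xs"
      by (rule nth_equalityI) (auto simp: vertical_projections_eq box cols m_def)
    moreover have "sort (vertical_projections P) = rev (map cc xs)"
      using nested_cells_fst(2)[OF P] sorted(1)
      by (intro properties_for_sort) (auto simp: vertical_projections_eq xs_def simp flip: cc_def)
    ultimately show ?thesis by simp
  qed
  moreover have "horizontal_projections Q = rev (sort (horizontal_projections P))"
  proof -
    have "horizontal_projections Q = map rc ys"
      by (rule nth_equalityI) (auto simp: horizontal_projections_eq box rows n_def rev_nth)
    moreover have "sort (horizontal_projections P) = rev (map rc ys)"
      using nested_cells_snd(2)[OF P] sorted(2)
      by (intro properties_for_sort) (auto simp: horizontal_projections_eq ys_def simp flip: rc_def)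
    ultimately show ?thesis by simp
  qed
  ultimately show ?thesis using box by blast
qed

text \<open>The definite description is meaningful: sorting provides a witness, and the row lengths
  leave no other candidate at the origin.\<close>

lemma projected_ferrer_diagram:
  assumes "nested_cells P"
  shows "ferrer_diagram (projected_ferrer_diagram P)"
    "horizontal_projections (projected_ferrer_diagram P) = rev (sort (horizontal_projections P))"
    "vertical_projections (projected_ferrer_diagram P) = rev (sort (vertical_projections P))"
proof -
  let ?F = "\<lambda>Q. ferrer_diagram Q \<and> box_left Q = 0 \<and> box_bottom Q = 0 \<and>
     horizontal_projections Q = rev (sort (horizontal_projections P)) \<and>
     vertical_projections Q = rev (sort (vertical_projections P))"
  let ?S = "\<lambda>h. {(x, y). y < length h \<and> x < rev h ! y}"
  have "Q = ?S (rev (sort (horizontal_projections P)))" if Q: "?F Q" for Q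
  proof -
    have "Q = ?S (horizontal_projections Q)" using Q by (intro ferrer_diagram_determined) blast+
    also have "horizontal_projections Q = rev (sort (horizontal_projections P))" using Q by blast
    finally show ?thesis .
  qed
  then have "\<exists>!Q. ?F Q" using projected_ferrer_diagram_exists[OF assms] by blast
  from theI'[OF this] show "ferrer_diagram (projected_ferrer_diagram P)"
    "horizontal_projections (projected_ferrer_diagram P) = rev (sort (horizontal_projections P))"
    "vertical_projections (projected_ferrer_diagram P) = rev (sort (vertical_projections P))"
    unfolding projected_ferrer_diagram_def by blast+
qed

theorem corollary1p7:
  fixes P :: "(nat \<times> nat) set"
  assumes "L_convex P"
  shows "bipartite_graph_isomorphic (polyomino_graph P)
           (polyomino_graph (projected_ferrer_diagram P))"
proof (rule polyomino_graph_isomorphicI)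
  show P: "nested_cells P" using assms by (rule L_convex_nested)
  show "nested_cells (projected_ferrer_diagram P)"
    using projected_ferrer_diagram(1)[OF P] by (rule ferrer_diagram_nested)
qed (simp_all add: projected_ferrer_diagram[OF L_convex_nested[OF assms]])

end
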